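(* For every positive even integer $n_0\neq 16$ there exists an $\langle n_0,n_0,n_0;t\rangle$-algorithm over $\mathbb{R}$ with $$t=\frac{n_0^3}{3}+\frac{15}{4}n_0^2+\frac{61}{6}n_0+8 .$$
   Context: For a matrix $X\in\mathbb{R}^{a\times b}$, $\vec{X}\in\mathbb{R}^{ab}$ denotes its row-major vectorization, i.e. the column vector listing the entries of $X$ row by row. $\odot$ denotes the Hadamard (entrywise) product of vectors. An $\langle m,n,p;t\rangle$-algorithm over $\mathbb{R}$ is a bilinear algorithm for multiplying an $m\times n$ matrix by an $n\times p$ matrix using $t$ multiplications; that is, a triplet $\langle U,V,W\rangle$ of matrices $U\in\mathbb{R}^{t\times mn}$, $V\in\mathbb{R}^{t\times np}$, $W\in\mathbb{R}^{t\times pm}$ such that for all $A\in\mathbb{R}^{m\times n}$ and $B\in\mathbb{R}^{n\times p}$, $$\overrightarrow{(AB)^T}=W^T\big((U\vec{A})\odot(V\vec{B})\big).$$ Equivalently, the tensor of $m\times n$ by $n\times p$ matrix multiplication over $\mathbb{R}$ has rank at most $t$. *)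

theory Defs
  imports Complex_Main "Jordan_Normal_Form.Matrix"
begin

text \<open>Row-major vectorization: with \<open>b\<close> columns, entry \<open>(i, j)\<close> sits at position \<open>i * b + j\<close>.\<close>

definition row_major_vec :: "'a mat \<Rightarrow> 'a vec" where
  "row_major_vec X =
     vec (dim_row X * dim_col X) (\<lambda>k. X $$ (k div dim_col X, k mod dim_col X))"

lemma row_major_vec_index:
  assumes "i < dim_row X" and "j < dim_col X"
  shows "row_major_vec X $ (i * dim_col X + j) = X $$ (i, j)"
proof -
  have "i * dim_col X + j < Suc i * dim_col X" using assms(2) by simp
  also have "\<dots> \<le> dim_row X * dim_col X" using assms(1) by (intro mult_right_mono) auto
  finally show ?thesis using assms(2) by (simp add: row_major_vec_def)
qed

text \<open>The Hadamard product is only meant for vectors of equal dimension.\<close>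

definition hadamard_vec :: "'a::times vec \<Rightarrow> 'a vec \<Rightarrow> 'a vec" (infixl "\<odot>\<^sub>v" 70) where
  "x \<odot>\<^sub>v y = vec (dim_vec x) (\<lambda>r. x $ r * y $ r)"

definition is_bilinear_mm_algorithm ::
  "nat \<Rightarrow> nat \<Rightarrow> nat \<Rightarrow> nat \<Rightarrow> real mat \<Rightarrow> real mat \<Rightarrow> real mat \<Rightarrow> bool" where
  "is_bilinear_mm_algorithm m n p t U V W \<longleftrightarrow>
     U \<in> carrier_mat t (m * n) \<and> V \<in> carrier_mat t (n * p) \<and> W \<in> carrier_mat t (p * m) \<and>
     (\<forall>A \<in> carrier_mat m n. \<forall>B \<in> carrier_mat n p.
        row_major_vec (transpose_mat (A * B)) =
          transpose_mat W *\<^sub>v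
            ((U *\<^sub>v row_major_vec A) \<odot>\<^sub>v (V *\<^sub>v row_major_vec B)))"

end

theory Submission
  imports Defs
begin

text \<open>Let \<open>n0 = 2 m\<close> and \<open>q = m + 1\<close>. The \<open>q \<times> q\<close> matrices with zero row and column sums form an algebra
  isomorphic to the \<open>m \<times> m\<close> matrices, compatibly with the trace, so it suffices to compute
  \<open>trace (A B C)\<close> for \<open>2 \<times> 2\<close> block matrices with such blocks. Pan's aggregation puts three wanted
  terms into each product. The fully mixed unwanted terms cancel in pairs by signs, and most of the
  others vanish because of the zero sums. What remains is, for every \<open>i \<noteq> j\<close>, a \<open>2 \<times> 2\<close> matrix
  multiplication of the \<open>(i, j)\<close> entries of the blocks (7 products by Strassen), and for every
  \<open>i\<close> a form in the diagonal entries which has rank at most 8 if \<open>q \<noteq> 9\<close>, that is \<open>n0 \<noteq> 16\<close>. The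
  total is \<open>8 (q\<^sup>3 - q) / 3 + 7 (q\<^sup>2 - q) + 8 q\<close>.\<close>

section \<open>Rank of trilinear forms\<close>

text \<open>Forms act on families indexed by all pairs of naturals, so one notion serves every
  matrix size; sizes enter only through the index ranges of a trilinear form.\<close>

definition linear_form :: "((nat \<Rightarrow> nat \<Rightarrow> real) \<Rightarrow> real) \<Rightarrow> bool" where
  "linear_form u \<longleftrightarrow> (\<forall>x y c. u (\<lambda>i j. x i j + c * y i j) = u x + c * u y)"

lemma linear_form_zero: "linear_form (\<lambda>x. 0)"
  by (simp add: linear_form_def)

lemma linear_form_entry: "linear_form (\<lambda>x. x i j)"
  by (simp add: linear_form_def)

lemma linear_form_add: "linear_form u \<Longrightarrow> linear_form v \<Longrightarrow> linear_form (\<lambda>x. u x + v x)"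
  by (simp add: linear_form_def algebra_simps)

lemma linear_form_uminus: "linear_form u \<Longrightarrow> linear_form (\<lambda>x. - u x)"
  by (simp add: linear_form_def algebra_simps)

lemma linear_form_diff: "linear_form u \<Longrightarrow> linear_form v \<Longrightarrow> linear_form (\<lambda>x. u x - v x)"
  by (simp add: linear_form_def algebra_simps)

lemma linear_form_cmult: "linear_form u \<Longrightarrow> linear_form (\<lambda>x. d * u x)"
  by (simp add: linear_form_def algebra_simps)

lemma linear_form_multc: "linear_form u \<Longrightarrow> linear_form (\<lambda>x. u x * d)"
  by (simp add: linear_form_def algebra_simps)

lemma linear_form_divide: "linear_form u \<Longrightarrow> linear_form (\<lambda>x. u x / d)"
  by (simp add: linear_form_def add_divide_distrib)

lemma linear_form_sum: "(\<And>i. i \<in> I \<Longrightarrow> linear_form (u i)) \<Longrightarrow> linear_form (\<lambda>x. \<Sum>i\<in>I. u i x)"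
  by (simp add: linear_form_def sum.distrib sum_distrib_left)

lemmas linear_form_intros =
  linear_form_zero linear_form_entry linear_form_add linear_form_uminus linear_form_diff
  linear_form_cmult linear_form_multc linear_form_divide linear_form_sum

definition unit_matrix :: "nat \<Rightarrow> nat \<Rightarrow> nat \<Rightarrow> nat \<Rightarrow> real" where
  "unit_matrix i j = (\<lambda>i' j'. if i' = i \<and> j' = j then 1 else 0)"

text \<open>On infinite families a linear form need not be determined by its values on unit
  matrices. On families of finite support it is, and matrices need no more.\<close>

lemma linear_form_restrict:
  assumes "linear_form u" and "finite I"
  shows "u (\<lambda>i j. if (i, j) \<in> I then x i j else 0) = (\<Sum>(i, j)\<in>I. u (unit_matrix i j) * x i j)"
  using assms(2)
proof (induction I)
  case empty
  show ?case
    \<comment> \<open>Linearity at the zero family with coefficient \<open>- 1\<close> gives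
      \<open>u 0 = u 0 - u 0\<close>.\<close>
    using assms(1)[unfolded linear_form_def, rule_format, of "\<lambda>i j. 0" "- 1" "\<lambda>i j. 0"]
    by simp
next
  case (insert e I)
  obtain i0 j0 where e: "e = (i0, j0)" by force
  have "(\<lambda>i j. if (i, j) \<in> insert e I then x i j else 0) =
      (\<lambda>i j. (if (i, j) \<in> I then x i j else 0) + x i0 j0 * unit_matrix i0 j0 i j)"
    using insert.hyps by (auto simp: e unit_matrix_def fun_eq_iff)
  then have "u (\<lambda>i j. if (i, j) \<in> insert e I then x i j else 0) =
      u (\<lambda>i j. if (i, j) \<in> I then x i j else 0) + x i0 j0 * u (unit_matrix i0 j0)"
    using assms(1) by (simp add: linear_form_def)
  then show ?case using insert by (simp add: e)
qed

type_synonym trilinear_form =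
  "(nat \<Rightarrow> nat \<Rightarrow> real) \<Rightarrow> (nat \<Rightarrow> nat \<Rightarrow> real) \<Rightarrow> (nat \<Rightarrow> nat \<Rightarrow> real) \<Rightarrow> real"

text \<open>The list has length exactly \<open>t\<close>, but its forms may vanish, so
  \<open>t\<close> is only an upper bound for the rank.\<close>

definition trilinear_rank_le :: "trilinear_form \<Rightarrow> nat \<Rightarrow> bool" where
  "trilinear_rank_le T t \<longleftrightarrow>
     (\<exists>xs. length xs = t \<and>
       (\<forall>(u, v, w)\<in>set xs. linear_form u \<and> linear_form v \<and> linear_form w) \<and>
       (\<forall>a b c. T a b c = (\<Sum>(u, v, w)\<leftarrow>xs. u a * v b * w c)))"

lemma trilinear_rank_le_zero: "trilinear_rank_le (\<lambda>a b c. 0) 0"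
  unfolding trilinear_rank_le_def by (rule exI[of _ "[]"]) simp

lemma trilinear_rank_le_product:
  assumes "linear_form u" "linear_form v" "linear_form w"
  shows "trilinear_rank_le (\<lambda>a b c. u a * v b * w c) 1"
  unfolding trilinear_rank_le_def using assms by (intro exI[of _ "[(u, v, w)]"]) simp

lemma trilinear_rank_le_add:
  assumes "trilinear_rank_le S s" and "trilinear_rank_le T t"
  shows "trilinear_rank_le (\<lambda>a b c. S a b c + T a b c) (s + t)"
proof -
  obtain xs where xs: "length xs = s"
    "\<forall>(u, v, w)\<in>set xs. linear_form u \<and> linear_form v \<and> linear_form w"
    "\<forall>a b c. S a b c = (\<Sum>(u, v, w)\<leftarrow>xs. u a * v b * w c)"
    using assms(1) unfolding trilinear_rank_le_def by blast
  obtain ys where ys: "length ys = t"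
    "\<forall>(u, v, w)\<in>set ys. linear_form u \<and> linear_form v \<and> linear_form w"
    "\<forall>a b c. T a b c = (\<Sum>(u, v, w)\<leftarrow>ys. u a * v b * w c)"
    using assms(2) unfolding trilinear_rank_le_def by blast
  show ?thesis unfolding trilinear_rank_le_def
    by (intro exI[of _ "xs @ ys"] conjI) (use xs ys in \<open>auto\<close>)
qed

lemma trilinear_rank_le_sum:
  assumes "finite I" and "\<And>i. i \<in> I \<Longrightarrow> trilinear_rank_le (T i) (t i)"
  shows "trilinear_rank_le (\<lambda>a b c. \<Sum>i\<in>I. T i a b c) (\<Sum>i\<in>I. t i)"
  using assms
  by (induction I) (simp_all add: trilinear_rank_le_zero trilinear_rank_le_add)

lemma trilinear_rank_le_sum_const:
  assumes "finite I" and "\<And>i. i \<in> I \<Longrightarrow> trilinear_rank_le (T i) t"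
  shows "trilinear_rank_le (\<lambda>a b c. \<Sum>i\<in>I. T i a b c) (card I * t)"
  using trilinear_rank_le_sum[of I T "\<lambda>_. t"] assms by simp

section \<open>From trilinear forms to the matrices of a bilinear algorithm\<close>

lemma sum_div_mod:
  fixes f :: "nat \<Rightarrow> nat \<Rightarrow> 'a::comm_monoid_add"
  shows "(\<Sum>l<m * n. f (l div n) (l mod n)) = (\<Sum>i<m. \<Sum>j<n. f i j)"
proof -
  have "(\<Sum>l<m * n. f (l div n) (l mod n)) =
      (\<Sum>i<m. \<Sum>l=i * n..<i * n + n. f (l div n) (l mod n))"
    by (simp add: sum.nat_group)
  also have "\<dots> = (\<Sum>i<m. \<Sum>j<n. f i j)"
  proof (rule sum.cong[OF refl])
    fix i
    have "(\<Sum>l=i * n..<i * n + n. f (l div n) (l mod n)) =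
        (\<Sum>j=0..<n. f ((j + i * n) div n) ((j + i * n) mod n))"
      using sum.shift_bounds_nat_ivl[of "\<lambda>l. f (l div n) (l mod n)" 0 "i * n" n]
      by (simp add: add.commute)
    also have "\<dots> = (\<Sum>j<n. f i j)"
      by (intro sum.cong) auto
    finally show "(\<Sum>l=i * n..<i * n + n. f (l div n) (l mod n)) = (\<Sum>j<n. f i j)" .
  qed
  finally show ?thesis .
qed

text \<open>Row \<open>r\<close> lists the values of \<open>u r\<close> on the unit matrices, so
  applying it to the vectorized \<open>A\<close> evaluates \<open>u r\<close> at \<open>A\<close>
  padded with zeros.\<close>

lemma linear_form_mult_row_major_vec:
  assumes "\<And>r. r < t \<Longrightarrow> linear_form (u r)" and "A \<in> carrier_mat m n" and "r < t"
  shows "(mat t (m * n) (\<lambda>(r, l). u r (unit_matrix (l div n) (l mod n))) *\<^sub>v row_major_vec A) $ r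
    = u r (\<lambda>i j. if i < m \<and> j < n then A $$ (i, j) else 0)"
proof -
  have "(mat t (m * n) (\<lambda>(r, l). u r (unit_matrix (l div n) (l mod n))) *\<^sub>v row_major_vec A) $ r
      = (\<Sum>l<m * n. u r (unit_matrix (l div n) (l mod n)) * A $$ (l div n, l mod n))"
    using assms(2,3) by (simp add: scalar_prod_def row_major_vec_def atLeast0LessThan)
  also have "\<dots> = (\<Sum>i<m. \<Sum>j<n. u r (unit_matrix i j) * A $$ (i, j))"
    by (rule sum_div_mod)
  also have "\<dots> = (\<Sum>(i, j)\<in>{..<m} \<times> {..<n}. u r (unit_matrix i j) * A $$ (i, j))"
    by (simp add: sum.cartesian_product)
  also have "\<dots> = u r (\<lambda>i j. if (i, j) \<in> {..<m} \<times> {..<n} then A $$ (i, j) else 0)"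
    using linear_form_restrict[of "u r" "{..<m} \<times> {..<n}" "\<lambda>i j. A $$ (i, j)"] assms(1)[OF assms(3)]
    by simp
  finally show ?thesis by simp
qed

text \<open>The trilinear form is the trace of \<open>a b c\<close>. A unit matrix in place of
  \<open>c\<close> picks out one entry of \<open>a b\<close>; its position is \<open>(k, i)\<close>
  for the entry \<open>(i, k)\<close>, which accounts for the transpose.\<close>

lemma bilinear_mm_algorithm_of_trilinear_rank:
  assumes "trilinear_rank_le (\<lambda>a b c. \<Sum>i<m. \<Sum>j<n. \<Sum>k<p. a i j * b j k * c k i) t"
  shows "\<exists>U V W. is_bilinear_mm_algorithm m n p t U V W"
proof -
  obtain xs where xs: "length xs = t"
    "\<forall>(u, v, w)\<in>set xs. linear_form u \<and> linear_form v \<and> linear_form w"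
    "\<forall>a b c. (\<Sum>i<m. \<Sum>j<n. \<Sum>k<p. a i j * b j k * c k i) = (\<Sum>(u, v, w)\<leftarrow>xs. u a * v b * w c)"
    using assms unfolding trilinear_rank_le_def by blast
  define u where "u r = fst (xs ! r)" for r
  define v where "v r = fst (snd (xs ! r))" for r
  define w where "w r = snd (snd (xs ! r))" for r
  have lin: "linear_form (u r)" "linear_form (v r)" if "r < t" for r
    using xs(2)[unfolded case_prod_unfold] nth_mem[of r xs] that xs(1)
    by (auto simp: u_def v_def w_def)
  have T: "(\<Sum>i<m. \<Sum>j<n. \<Sum>k<p. a i j * b j k * c k i) = (\<Sum>r<t. u r a * v r b * w r c)" for a b c
    using xs(1,3) by (simp add: sum_list_sum_nth atLeast0LessThan u_def v_def w_def case_prod_unfold)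
  define U where "U = mat t (m * n) (\<lambda>(r, l). u r (unit_matrix (l div n) (l mod n)))"
  define V where "V = mat t (n * p) (\<lambda>(r, l). v r (unit_matrix (l div p) (l mod p)))"
  define W where "W = mat t (p * m) (\<lambda>(r, l). w r (unit_matrix (l div m) (l mod m)))"
  have "row_major_vec (transpose_mat (A * B)) =
      transpose_mat W *\<^sub>v ((U *\<^sub>v row_major_vec A) \<odot>\<^sub>v (V *\<^sub>v row_major_vec B))"
    if A: "A \<in> carrier_mat m n" and B: "B \<in> carrier_mat n p" for A B
  proof (rule eq_vecI)
    show "dim_vec (row_major_vec (transpose_mat (A * B))) =
      dim_vec (transpose_mat W *\<^sub>v ((U *\<^sub>v row_major_vec A) \<odot>\<^sub>v (V *\<^sub>v row_major_vec B)))"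
      using A B by (simp add: row_major_vec_def W_def)
    fix l
    assume "l < dim_vec (transpose_mat W *\<^sub>v ((U *\<^sub>v row_major_vec A) \<odot>\<^sub>v (V *\<^sub>v row_major_vec B)))"
    then have l: "l < p * m" by (simp add: W_def)
    then have "m > 0" by (cases m) auto
    define k i where "k = l div m" and "i = l mod m"
    have i: "i < m" using \<open>m > 0\<close> by (simp add: i_def)
    have k: "k < p" using l by (simp add: k_def less_mult_imp_div_less)
    let ?a = "\<lambda>i j. if i < m \<and> j < n then A $$ (i, j) else 0"
    let ?b = "\<lambda>i j. if i < n \<and> j < p then B $$ (i, j) else 0"
    have "(transpose_mat W *\<^sub>v ((U *\<^sub>v row_major_vec A) \<odot>\<^sub>v (V *\<^sub>v row_major_vec B))) $ l =
        (\<Sum>r<t. w r (unit_matrix k i) * ((U *\<^sub>v row_major_vec A) $ r * (V *\<^sub>v row_major_vec B) $ r))"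
      using l by (simp add: W_def U_def V_def hadamard_vec_def scalar_prod_def k_def i_def atLeast0LessThan)
    also have "\<dots> = (\<Sum>r<t. u r ?a * v r ?b * w r (unit_matrix k i))"
      unfolding U_def V_def
      using linear_form_mult_row_major_vec[of t u A m n] linear_form_mult_row_major_vec[of t v B n p] lin A B
      by (intro sum.cong refl) (simp only: lessThan_iff ac_simps)
    also have "\<dots> = (\<Sum>i'<m. \<Sum>j<n. \<Sum>k'<p. ?a i' j * ?b j k' * unit_matrix k i k' i')"
      by (rule T[symmetric])
    also have "\<dots> = (\<Sum>i'<m. \<Sum>j<n. \<Sum>k'<p.
        if k' = k then (if i' = i then ?a i j * ?b j k else 0) else 0)"
      by (intro sum.cong) (auto simp: unit_matrix_def)
    also have "\<dots> = (\<Sum>i'<m. if i' = i then (\<Sum>j<n. ?a i j * ?b j k) else 0)"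
      using k by (intro sum.cong) (auto simp: sum.delta)
    also have "\<dots> = (\<Sum>j<n. ?a i j * ?b j k)"
      using i by (simp add: sum.delta)
    also have "\<dots> = (A * B) $$ (i, k)"
      using A B i k by (simp add: scalar_prod_def atLeast0LessThan)
    also have "\<dots> = row_major_vec (transpose_mat (A * B)) $ l"
      using A B i k l by (simp add: row_major_vec_def k_def i_def)
    finally show "row_major_vec (transpose_mat (A * B)) $ l =
      (transpose_mat W *\<^sub>v ((U *\<^sub>v row_major_vec A) \<odot>\<^sub>v (V *\<^sub>v row_major_vec B))) $ l" ..
  qed
  then have "is_bilinear_mm_algorithm m n p t U V W"
    unfolding is_bilinear_mm_algorithm_def U_def V_def W_def by auto
  then show ?thesis by blast
qed


section \<open>Two by two blocks\<close>

text \<open>Strassen's algorithm has the product (trace of x) times (trace of y), whose third factor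
  can be changed by an arbitrary linear form \<open>l\<close> for free.\<close>

lemma trilinear_rank_le_strassen:
  assumes [intro]: "linear_form x00" "linear_form x01" "linear_form x10" "linear_form x11"
    "linear_form y00" "linear_form y01" "linear_form y10" "linear_form y11"
    "linear_form z00" "linear_form z01" "linear_form z10" "linear_form z11" "linear_form l"
  shows "trilinear_rank_le (\<lambda>a b c.
      (y00 b * x00 a + y01 b * x10 a) * z00 c + (y00 b * x01 a + y01 b * x11 a) * z10 c +
      (y10 b * x00 a + y11 b * x10 a) * z01 c + (y10 b * x01 a + y11 b * x11 a) * z11 c +
      (x00 a + x11 a) * (y00 b + y11 b) * l c) 7"
  unfolding trilinear_rank_le_def
proof (intro exI conjI allI)
  let ?xs = "[
    (\<lambda>a. x00 a + x11 a, \<lambda>b. y00 b + y11 b, \<lambda>c. z00 c + z11 c + l c),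
    (\<lambda>a. x00 a, \<lambda>b. y10 b + y11 b, \<lambda>c. z01 c - z11 c),
    (\<lambda>a. x01 a - x11 a, \<lambda>b. y00 b, \<lambda>c. z10 c + z11 c),
    (\<lambda>a. x10 a - x00 a, \<lambda>b. y11 b, \<lambda>c. z00 c + z01 c),
    (\<lambda>a. x11 a, \<lambda>b. y00 b + y01 b, \<lambda>c. z10 c - z00 c),
    (\<lambda>a. x00 a + x01 a, \<lambda>b. y10 b - y00 b, \<lambda>c. z11 c),
    (\<lambda>a. x10 a + x11 a, \<lambda>b. y01 b - y11 b, \<lambda>c. z00 c)]"
  show "length ?xs = 7" by simp
  show "\<forall>(u, v, w)\<in>set ?xs. linear_form u \<and> linear_form v \<and> linear_form w"
    by (auto intro!: linear_form_intros)
  fix a b c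
  show "(y00 b * x00 a + y01 b * x10 a) * z00 c + (y00 b * x01 a + y01 b * x11 a) * z10 c +
      (y10 b * x00 a + y11 b * x10 a) * z01 c + (y10 b * x01 a + y11 b * x11 a) * z11 c +
      (x00 a + x11 a) * (y00 b + y11 b) * l c = (\<Sum>(u, v, w)\<leftarrow>?xs. u a * v b * w c)"
    by (simp add: algebra_simps)
qed

definition sg :: "bool \<Rightarrow> real" where
  "sg s = (if s then - 1 else 1)"

text \<open>The signs come from multiplying each of the three block matrices by \<open>diag (1, -1)\<close> on the
  right: up to these signs, this is the trace of the \<open>2 \<times> 2\<close> product \<open>a c b\<close>.\<close>

definition block_form :: "(bool \<Rightarrow> bool \<Rightarrow> real) \<Rightarrow> (bool \<Rightarrow> bool \<Rightarrow> real) \<Rightarrow> (bool \<Rightarrow> bool \<Rightarrow> real) \<Rightarrow> real" where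
  "block_form a b c = (\<Sum>s\<in>UNIV. \<Sum>t\<in>UNIV. \<Sum>u\<in>UNIV. sg s * sg t * sg u * (a s t * b u s * c t u))"

text \<open>The signed sum of the aggregates at \<open>i = j = k\<close>, where all summands of a
  factor are taken at the same diagonal position of the blocks.\<close>

definition diagonal_aggregate :: "(bool \<Rightarrow> bool \<Rightarrow> real) \<Rightarrow> (bool \<Rightarrow> bool \<Rightarrow> real) \<Rightarrow> (bool \<Rightarrow> bool \<Rightarrow> real) \<Rightarrow> real" where
  "diagonal_aggregate a b c = (\<Sum>s\<in>UNIV. \<Sum>t\<in>UNIV. \<Sum>u\<in>UNIV. sg s * sg t * sg u *
     ((a s t + a u s + a t u) * (b t u + b s t + b u s) * (c u s + c t u + c s t)))"

lemma trilinear_rank_le_block_form: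
  assumes [intro]: "\<And>s t. linear_form (\<lambda>a. A a s t)" "\<And>s t. linear_form (\<lambda>b. B b s t)"
    "\<And>s t. linear_form (\<lambda>c. C c s t)"
  shows "trilinear_rank_le (\<lambda>a b c. d * block_form (A a) (B b) (C c)) 7"
proof -
  \<comment> \<open>Strassen with \<open>l = 0\<close>: the forms in \<open>A\<close> absorb
    \<open>d * sg s * sg t\<close>, those in \<open>C\<close> absorb \<open>sg u\<close>.\<close>
  have "trilinear_rank_le (\<lambda>a b c.
      (B b False False * (d * A a False False) + B b False True * (- d * A a True False)) * C c False False
      + (B b False False * (- d * A a False True) + B b False True * (d * A a True True)) * C c True False
      + (B b True False * (d * A a False False) + B b True True * (- d * A a True False)) * (- C c False True)
      + (B b True False * (- d * A a False True) + B b True True * (d * A a True True)) * (- C c True True)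
      + (d * A a False False + d * A a True True) * (B b False False + B b True True) * 0) 7"
    by (rule trilinear_rank_le_strassen) (auto intro!: linear_form_intros)
  then show ?thesis
    by (simp add: block_form_def UNIV_bool sg_def algebra_simps)
qed

text \<open>The diagonal form is the sum of one product and a weighted \<open>2 \<times> 2\<close> matrix multiplication minus
  another product. In the coordinates \<open>x, y, z\<close> below, the latter two become an unweighted
  multiplication plus a multiple of (trace of x) times (trace of y). The change of coordinates
  divides by \<open>9 - q\<close>.\<close>

lemma trilinear_rank_le_diagonal:
  assumes [intro]: "\<And>s t. linear_form (\<lambda>a. A a s t)" "\<And>s t. linear_form (\<lambda>b. B b s t)"
    "\<And>s t. linear_form (\<lambda>c. C c s t)"
    and q: "q \<noteq> 0" "q \<noteq> 9"
  shows "trilinear_rank_le (\<lambda>a b c. diagonal_aggregate (A a) (B b) (C c) / 3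
    - q * block_form (A a) (B b) (C c)) 8"
proof -
  \<comment> \<open>The weight of \<open>a00 b00 c00\<close> in \<open>?D\<close> outside the two
    full products: equal block indices contribute \<open>27 / 3\<close>, and the block form takes
    away \<open>q\<close>.\<close>
  define p where "p = 9 - q"
  have p: "p \<noteq> 0" using q by (simp add: p_def)
  let ?a00 = "\<lambda>a. A a False False" and ?a01 = "\<lambda>a. A a False True"
  let ?a10 = "\<lambda>a. A a True False" and ?a11 = "\<lambda>a. A a True True"
  let ?b00 = "\<lambda>b. B b False False" and ?b01 = "\<lambda>b. B b False True"
  let ?b10 = "\<lambda>b. B b True False" and ?b11 = "\<lambda>b. B b True True"
  let ?c00 = "\<lambda>c. C c False False" and ?c01 = "\<lambda>c. C c False True"
  let ?c10 = "\<lambda>c. C c True False" and ?c11 = "\<lambda>c. C c True True"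
  \<comment> \<open>\<open>?x00 + ?x11\<close>, \<open>?y00 + ?y11\<close> and \<open>- ?l\<close>
    are the three factors of the product that \<open>?D\<close> subtracts.\<close>
  let ?x00 = "\<lambda>a. ?a00 a + ?a10 a" and ?x01 = "\<lambda>a. ?a01 a - p / q * ?a11 a"
  let ?x10 = "\<lambda>a. ?a00 a" and ?x11 = "\<lambda>a. ?a01 a"
  let ?w00 = "\<lambda>b. (1 + p / q) * ?b00 b + ?b10 b"
  let ?w01 = "\<lambda>b. (1 + p / q) * (?b01 b / p) - ?b11 b / q"
  let ?w10 = "\<lambda>b. ?b00 b + ?b10 b" and ?w11 = "\<lambda>b. ?b01 b / p - ?b11 b / q"
  let ?y00 = "\<lambda>b. q * ?w01 b" and ?y01 = "\<lambda>b. ?w00 b - q * ?w01 b"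
  let ?y10 = "\<lambda>b. q * ?w11 b" and ?y11 = "\<lambda>b. ?w10 b - q * ?w11 b"
  let ?z00 = "\<lambda>c. q / p * (p * ?c00 c - q * ?c01 c)"
  let ?z01 = "\<lambda>c. q / p * (- (p * ?c00 c) + (1 + p / q) * (q * ?c01 c))"
  let ?z10 = "\<lambda>c. q / p * (q * ?c10 c + q * ?c11 c)"
  let ?z11 = "\<lambda>c. q / p * (- (q * ?c10 c) - (1 + p / q) * (q * ?c11 c))"
  let ?l = "\<lambda>c. - (?c10 c + ?c01 c + ?c00 c)"
  have "trilinear_rank_le (\<lambda>a b c.
      (?y00 b * ?x00 a + ?y01 b * ?x10 a) * ?z00 c + (?y00 b * ?x01 a + ?y01 b * ?x11 a) * ?z10 c +
      (?y10 b * ?x00 a + ?y11 b * ?x10 a) * ?z01 c + (?y10 b * ?x01 a + ?y11 b * ?x11 a) * ?z11 c +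
      (?x00 a + ?x11 a) * (?y00 b + ?y11 b) * ?l c) 7"
    by (rule trilinear_rank_le_strassen) (auto intro!: linear_form_intros)
  moreover have "trilinear_rank_le (\<lambda>a b c.
      (?a01 a + ?a10 a + ?a11 a) * (?b11 b + ?b01 b + ?b10 b) * (?c10 c + ?c11 c + ?c01 c)) 1"
    by (rule trilinear_rank_le_product) (auto intro!: linear_form_intros)
  ultimately have rank: "trilinear_rank_le (\<lambda>a b c.
      ((?y00 b * ?x00 a + ?y01 b * ?x10 a) * ?z00 c + (?y00 b * ?x01 a + ?y01 b * ?x11 a) * ?z10 c +
      (?y10 b * ?x00 a + ?y11 b * ?x10 a) * ?z01 c + (?y10 b * ?x01 a + ?y11 b * ?x11 a) * ?z11 c +
      (?x00 a + ?x11 a) * (?y00 b + ?y11 b) * ?l c) +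
      (?a01 a + ?a10 a + ?a11 a) * (?b11 b + ?b01 b + ?b10 b) * (?c10 c + ?c11 c + ?c01 c)) (7 + 1)"
    by (rule trilinear_rank_le_add)
  have eq: "((?y00 b * ?x00 a + ?y01 b * ?x10 a) * ?z00 c + (?y00 b * ?x01 a + ?y01 b * ?x11 a) * ?z10 c +
      (?y10 b * ?x00 a + ?y11 b * ?x10 a) * ?z01 c + (?y10 b * ?x01 a + ?y11 b * ?x11 a) * ?z11 c +
      (?x00 a + ?x11 a) * (?y00 b + ?y11 b) * ?l c) +
      (?a01 a + ?a10 a + ?a11 a) * (?b11 b + ?b01 b + ?b10 b) * (?c10 c + ?c11 c + ?c01 c)
    = diagonal_aggregate (A a) (B b) (C c) / 3 - q * block_form (A a) (B b) (C c)" for a b c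
  proof -
    \<comment> \<open>The three choices of \<open>s, t, u\<close> with exactly one
      \<open>True\<close> give one and the same product, and so do the three with exactly two.
      Division by 3 leaves one copy of each, with opposite signs.\<close>
    let ?D = "p * (?a00 a * ?b00 b * ?c00 c - ?a11 a * ?b11 b * ?c11 c)
       + q * (?a00 a * ?b10 b * ?c01 c + ?a01 a * ?b00 b * ?c10 c + ?a10 a * ?b01 b * ?c00 c)
       - q * (?a01 a * ?b10 b * ?c11 c + ?a10 a * ?b11 b * ?c01 c + ?a11 a * ?b01 b * ?c10 c)
       - (?a00 a + ?a10 a + ?a01 a) * (?b01 b + ?b00 b + ?b10 b) * (?c10 c + ?c01 c + ?c00 c)
       + (?a01 a + ?a10 a + ?a11 a) * (?b11 b + ?b01 b + ?b10 b) * (?c10 c + ?c11 c + ?c01 c)"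
    have "diagonal_aggregate (A a) (B b) (C c) = 3 * (q * block_form (A a) (B b) (C c) + ?D)"
      by (simp add: diagonal_aggregate_def block_form_def UNIV_bool sg_def p_def algebra_simps)
    moreover have "x / 3 - y = z" if "x = 3 * (y + z)" for x :: real and y z
      using that by (simp add: field_simps)
    ultimately have D: "diagonal_aggregate (A a) (B b) (C c) / 3 - q * block_form (A a) (B b) (C c) = ?D"
      by blast
    show ?thesis unfolding D using p q(1)
      by (simp add: divide_simps) (simp add: algebra_simps)
  qed
  show ?thesis using rank unfolding eq by simp
qed

section \<open>Trilinear aggregation\<close>

definition sum3 :: "nat \<Rightarrow> (nat \<Rightarrow> nat \<Rightarrow> nat \<Rightarrow> real) \<Rightarrow> real" where
  "sum3 q f = (\<Sum>i<q. \<Sum>j<q. \<Sum>k<q. f i j k)"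

lemma sum3_add: "sum3 q (\<lambda>i j k. f i j k + g i j k) = sum3 q f + sum3 q g"
  by (simp add: sum3_def sum.distrib)

lemma sum3_cmult: "sum3 q (\<lambda>i j k. d * f i j k) = d * sum3 q f"
  by (simp add: sum3_def sum_distrib_left)

lemma sum3_rotate: "sum3 q (\<lambda>i j k. f j k i) = sum3 q f"
proof -
  have "sum3 q (\<lambda>i j k. f j k i) = (\<Sum>j<q. \<Sum>i<q. \<Sum>k<q. f j k i)"
    unfolding sum3_def by (rule sum.swap)
  also have "\<dots> = sum3 q f"
    unfolding sum3_def by (intro sum.cong refl sum.swap)
  finally show ?thesis .
qed

text \<open>\<open>x\<close> and \<open>y\<close> are unbounded so that the equations rewrite
  without range conditions.\<close>

definition zero_sums :: "nat \<Rightarrow> (nat \<Rightarrow> nat \<Rightarrow> real) \<Rightarrow> bool" where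
  "zero_sums q f \<longleftrightarrow> (\<forall>x. (\<Sum>y<q. f x y) = 0) \<and> (\<forall>y. (\<Sum>x<q. f x y) = 0)"

text \<open>In the first sum \<open>p i j\<close> is independent of \<open>k\<close>, while
  \<open>y k i\<close> and \<open>z j k\<close> each sum to zero over \<open>k\<close>. The other
  two sums are its rotations.\<close>

lemma sum3_zero_sums:
  assumes "zero_sums q y" "zero_sums q z"
  shows "sum3 q (\<lambda>i j k. p i j * (y k i + z j k)) = 0"
    and "sum3 q (\<lambda>i j k. p j k * (y i j + z k i)) = 0"
    and "sum3 q (\<lambda>i j k. p k i * (y j k + z i j)) = 0"
proof -
  show 1: "sum3 q (\<lambda>i j k. p i j * (y k i + z j k)) = 0"
    using assms by (simp add: sum3_def zero_sums_def sum.distrib flip: sum_distrib_left)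
  show 2: "sum3 q (\<lambda>i j k. p j k * (y i j + z k i)) = 0"
    using sum3_rotate[of q "\<lambda>i j k. p i j * (y k i + z j k)"] 1 by simp
  show "sum3 q (\<lambda>i j k. p k i * (y j k + z i j)) = 0"
    using sum3_rotate[of q "\<lambda>i j k. p j k * (y i j + z k i)"] 2 by simp
qed

text \<open>Of the 27 expanded terms, 6 have three different index pairs and 3 have a single pair,
  whose free index contributes \<open>q\<close>. In the other 18 exactly two factors share a pair,
  and the third sums to zero over the remaining index.\<close>

lemma sum3_aggregate:
  assumes z: "zero_sums q f1" "zero_sums q f2" "zero_sums q f3" "zero_sums q g1" "zero_sums q g2"
    "zero_sums q g3" "zero_sums q h1" "zero_sums q h2" "zero_sums q h3"
  shows "sum3 q (\<lambda>i j k. (f1 i j + f2 j k + f3 k i) * (g1 j k + g2 k i + g3 i j)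
      * (h1 k i + h2 i j + h3 j k)) =
    sum3 q (\<lambda>i j k. f1 i j * g1 j k * h1 k i) + sum3 q (\<lambda>i j k. f2 i j * g2 j k * h2 k i)
    + sum3 q (\<lambda>i j k. f3 i j * g3 j k * h3 k i)
    + (sum3 q (\<lambda>i j k. f1 i j * g2 k i * h3 j k) + sum3 q (\<lambda>i j k. f2 i j * g3 k i * h1 j k)
    + sum3 q (\<lambda>i j k. f3 i j * g1 k i * h2 j k))
    + q * ((\<Sum>i<q. \<Sum>j<q. f1 i j * g3 i j * h2 i j) + (\<Sum>i<q. \<Sum>j<q. f2 i j * g1 i j * h3 i j)
    + (\<Sum>i<q. \<Sum>j<q. f3 i j * g2 i j * h1 i j))"
proof -
  have rot2: "sum3 q (\<lambda>i j k. f k i j) = sum3 q f" for f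
    using sum3_rotate[of q f] sum3_rotate[of q "\<lambda>i j k. f j k i"] by simp
  have diag: "sum3 q (\<lambda>i j k. f i j) = q * (\<Sum>i<q. \<Sum>j<q. f i j)" for f :: "nat \<Rightarrow> nat \<Rightarrow> real"
    by (simp add: sum3_def sum_distrib_left)
  have "sum3 q (\<lambda>i j k. (f1 i j + f2 j k + f3 k i) * (g1 j k + g2 k i + g3 i j)
      * (h1 k i + h2 i j + h3 j k)) =
    sum3 q (\<lambda>i j k.
      f1 i j * g1 j k * h1 k i + f2 j k * g2 k i * h2 i j + f3 k i * g3 i j * h3 j k
    + (f1 i j * g2 k i * h3 j k + f2 j k * g3 i j * h1 k i + f3 k i * g1 j k * h2 i j)
    + (f1 i j * g3 i j * h2 i j + f2 j k * g1 j k * h3 j k + f3 k i * g2 k i * h1 k i)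
    + (f1 i j * g3 i j * (h1 k i + h3 j k) + f1 i j * h2 i j * (g2 k i + g1 j k)
       + g3 i j * h2 i j * (f3 k i + f2 j k))
    + (f2 j k * g1 j k * (h2 i j + h1 k i) + f2 j k * h3 j k * (g3 i j + g2 k i)
       + g1 j k * h3 j k * (f1 i j + f3 k i))
    + (f3 k i * g2 k i * (h3 j k + h2 i j) + f3 k i * h1 k i * (g1 j k + g3 i j)
       + g2 k i * h1 k i * (f2 j k + f1 i j)))"
    by (intro arg_cong[where f = "sum3 q"] ext) (simp only: distrib_left distrib_right ac_simps)
  then show ?thesis
    using sum3_rotate[of q "\<lambda>i j k. f2 i j * g2 j k * h2 k i"]
      rot2[of "\<lambda>i j k. f3 i j * g3 j k * h3 k i"]
      sum3_rotate[of q "\<lambda>i j k. f2 i j * g3 k i * h1 j k"]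
      rot2[of "\<lambda>i j k. f3 i j * g1 k i * h2 j k"]
      diag[of "\<lambda>i j. f1 i j * g3 i j * h2 i j"]
      sum3_rotate[of q "\<lambda>i j k. f2 i j * g1 i j * h3 i j"] diag[of "\<lambda>i j. f2 i j * g1 i j * h3 i j"]
      rot2[of "\<lambda>i j k. f3 i j * g2 i j * h1 i j"] diag[of "\<lambda>i j. f3 i j * g2 i j * h1 i j"]
      sum3_zero_sums(1)[OF z(7,9), of "\<lambda>i j. f1 i j * g3 i j"]
      sum3_zero_sums(1)[OF z(5,4), of "\<lambda>i j. f1 i j * h2 i j"]
      sum3_zero_sums(1)[OF z(3,2), of "\<lambda>i j. g3 i j * h2 i j"]
      sum3_zero_sums(2)[OF z(8,7), of "\<lambda>i j. f2 i j * g1 i j"]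
      sum3_zero_sums(2)[OF z(6,5), of "\<lambda>i j. f2 i j * h3 i j"]
      sum3_zero_sums(2)[OF z(1,3), of "\<lambda>i j. g1 i j * h3 i j"]
      sum3_zero_sums(3)[OF z(9,8), of "\<lambda>i j. f3 i j * g2 i j"]
      sum3_zero_sums(3)[OF z(4,6), of "\<lambda>i j. f3 i j * h1 i j"]
      sum3_zero_sums(3)[OF z(2,1), of "\<lambda>i j. g2 i j * h1 i j"]
    by (simp only: sum3_add) (simp add: distrib_left)
qed

section \<open>Signed aggregates of block matrices\<close>

type_synonym blocks = "bool \<Rightarrow> bool \<Rightarrow> nat \<Rightarrow> nat \<Rightarrow> real"

text \<open>The block labels rotate against \<open>i, j, k\<close>. Hence a fully mixed term such as
  \<open>A s t i j * B s t k i * C s t j k\<close> carries only one pair of labels.\<close>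

definition aggregate :: "blocks \<Rightarrow> blocks \<Rightarrow> blocks \<Rightarrow> bool \<Rightarrow> bool \<Rightarrow> bool \<Rightarrow> nat \<Rightarrow> nat \<Rightarrow> nat \<Rightarrow> real" where
  "aggregate A B C s t u i j k = (A s t i j + A u s j k + A t u k i)
     * (B t u j k + B s t k i + B u s i j) * (C u s k i + C t u i j + C s t j k)"

definition aggregates :: "blocks \<Rightarrow> blocks \<Rightarrow> blocks \<Rightarrow> nat \<Rightarrow> nat \<Rightarrow> nat \<Rightarrow> real" where
  "aggregates A B C i j k =
     (\<Sum>s\<in>UNIV. \<Sum>t\<in>UNIV. \<Sum>u\<in>UNIV. sg s * sg t * sg u * aggregate A B C s t u i j k)"

text \<open>The trace of \<open>A B C\<close> after each block matrix is multiplied by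
  \<open>diag (1, -1)\<close> on the right.\<close>

definition signed_trace :: "nat \<Rightarrow> blocks \<Rightarrow> blocks \<Rightarrow> blocks \<Rightarrow> real" where
  "signed_trace q A B C = (\<Sum>s\<in>UNIV. \<Sum>t\<in>UNIV. \<Sum>u\<in>UNIV.
     sg s * sg t * sg u * sum3 q (\<lambda>i j k. A s t i j * B t u j k * C u s k i))"

abbreviation (input) entry :: "blocks \<Rightarrow> nat \<Rightarrow> nat \<Rightarrow> bool \<Rightarrow> bool \<Rightarrow> real" where
  "entry A i j \<equiv> (\<lambda>s t. A s t i j)"

text \<open>Rotating \<open>i, j, k\<close> amounts to rotating \<open>s, t, u\<close>, which only
  reorders the sum and keeps the sign.\<close>

lemma aggregates_rotate: "aggregates A B C j k i = aggregates A B C i j k"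
  by (simp add: aggregates_def aggregate_def UNIV_bool sg_def) (simp add: ac_simps)

text \<open>The unwanted products \<open>A s t i j * B s t k i * C s t j k\<close> do not depend on \<open>u\<close>, so they cancel
  by the sign.\<close>

lemma sum3_aggregates:
  assumes "\<And>s t. zero_sums q (A s t)" "\<And>s t. zero_sums q (B s t)" "\<And>s t. zero_sums q (C s t)"
  shows "sum3 q (aggregates A B C) =
    3 * signed_trace q A B C + 3 * (q * (\<Sum>i<q. \<Sum>j<q. block_form (entry A i j) (entry B i j) (entry C i j)))"
proof -
  define W where "W f g h = sum3 q (\<lambda>i j k. f i j * g j k * h k i)" for f g h
  define V where "V f g h = sum3 q (\<lambda>i j k. f i j * g k i * h j k)" for f g h
  define E where "E f g h = (\<Sum>i<q. \<Sum>j<q. f i j * g i j * h i j :: real)" for f g h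
  have agg: "sum3 q (aggregate A B C s t u) =
      W (A s t) (B t u) (C u s) + W (A u s) (B s t) (C t u) + W (A t u) (B u s) (C s t)
      + (V (A s t) (B s t) (C s t) + V (A u s) (B u s) (C u s) + V (A t u) (B t u) (C t u))
      + q * (E (A s t) (B u s) (C t u) + E (A u s) (B t u) (C s t) + E (A t u) (B s t) (C u s))" for s t u
    unfolding aggregate_def W_def V_def E_def by (rule sum3_aggregate) (rule assms)+
  have total: "sum3 q (aggregates A B C) = (\<Sum>s\<in>UNIV. \<Sum>t\<in>UNIV. \<Sum>u\<in>UNIV.
      sg s * sg t * sg u * sum3 q (aggregate A B C s t u))"
    unfolding aggregates_def by (simp add: UNIV_bool sum3_add sum3_cmult)
  have K: "(\<Sum>i<q. \<Sum>j<q. block_form (entry A i j) (entry B i j) (entry C i j)) =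
      (\<Sum>s\<in>UNIV. \<Sum>t\<in>UNIV. \<Sum>u\<in>UNIV. sg s * sg t * sg u * E (A s t) (B u s) (C t u))"
    by (simp add: block_form_def E_def UNIV_bool sum.distrib sum_distrib_left)
  show ?thesis
    \<comment> \<open>Cyclic relabelling of \<open>s, t, u\<close> makes the three \<open>W\<close>
      sums equal, and likewise the three \<open>E\<close> sums; hence both factors 3.\<close>
    unfolding total K agg signed_trace_def W_def[symmetric]
    by (simp add: UNIV_bool sg_def algebra_simps)
qed

section \<open>Rotation orbits of index triples\<close>

text \<open>One triple from each orbit of size 3: a minimal index comes first, and the strict
  \<open>i < k\<close> breaks the tie when the minimum occurs twice.\<close>

definition cyclic_representatives :: "nat \<Rightarrow> (nat \<times> nat \<times> nat) set" where
  "cyclic_representatives q = {x \<in> {..<q} \<times> {..<q} \<times> {..<q}. case x of (i, j, k) \<Rightarrow> i \<le> j \<and> i < k}"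

lemma finite_cyclic_representatives: "finite (cyclic_representatives q)"
  unfolding cyclic_representatives_def by (rule finite_subset[of _ "{..<q} \<times> {..<q} \<times> {..<q}"]) auto

lemma sum3_cyclic:
  assumes "\<And>i j k. g j k i = g i j k"
  shows "sum3 q g = (\<Sum>i<q. g i i i) + 3 * (\<Sum>(i, j, k)\<in>cyclic_representatives q. g i j k)"
proof -
  let ?r = "\<lambda>i j k. if i \<le> j \<and> i < k then g i j k else 0"
  \<comment> \<open>Exactly one of the three rotations of a triple passes the test, or none if all
    indices agree.\<close>
  have "sum3 q g = sum3 q (\<lambda>i j k. (if j = i then if k = i then g i i i else 0 else 0)
      + (?r i j k + (?r j k i + ?r k i j)))"
    by (intro arg_cong[where f = "sum3 q"] ext) (auto simp: assms)
  also have "\<dots> = sum3 q (\<lambda>i j k. if j = i then if k = i then g i i i else 0 else 0)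
      + (sum3 q ?r + (sum3 q ?r + sum3 q ?r))"
    using sum3_rotate[of q ?r] sum3_rotate[of q "\<lambda>i j k. ?r j k i"]
    by (simp only: sum3_add)
  also have "sum3 q (\<lambda>i j k. if j = i then if k = i then g i i i else 0 else 0) = (\<Sum>i<q. g i i i)"
    unfolding sum3_def
  proof (intro sum.cong refl)
    fix i assume "i \<in> {..<q}"
    then have "(\<Sum>k<q. if k = i then g i i i else 0) = g i i i" by (simp add: sum.delta)
    then have "(\<Sum>j<q. \<Sum>k<q. if j = i then if k = i then g i i i else 0 else 0) =
        (\<Sum>j<q. if j = i then g i i i else 0)"
      by (intro sum.cong) auto
    then show "(\<Sum>j<q. \<Sum>k<q. if j = i then if k = i then g i i i else 0 else 0) = g i i i"
      using \<open>i \<in> {..<q}\<close> by (simp add: sum.delta)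
  qed
  also have "sum3 q ?r = (\<Sum>(i, j, k)\<in>cyclic_representatives q. g i j k)"
    unfolding sum3_def cyclic_representatives_def
    by (subst sum.inter_filter) (simp_all add: sum.cartesian_product case_prod_unfold cong: if_cong)
  finally show ?thesis by simp
qed

lemma card_cyclic_representatives: "real q + 3 * card (cyclic_representatives q) = real q ^ 3"
  using sum3_cyclic[of "\<lambda>i j k. 1" q] by (simp add: sum3_def power3_eq_cube)

text \<open>This is the aggregation identity divided by 3: an orbit of size 3 is counted once, a
  fixed triple with weight \<open>1 / 3\<close>. The diagonal block forms are joined to the fixed
  triples because the combination has rank at most 8.\<close>

lemma signed_trace_eq:
  assumes "\<And>s t. zero_sums q (A s t)" "\<And>s t. zero_sums q (B s t)" "\<And>s t. zero_sums q (C s t)"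
  shows "signed_trace q A B C =
    (\<Sum>(i, j, k)\<in>cyclic_representatives q. aggregates A B C i j k)
    + (\<Sum>(i, j)\<in>{..<q} \<times> {..<q} - (\<lambda>i. (i, i)) ` {..<q}.
        - real q * block_form (entry A i j) (entry B i j) (entry C i j))
    + (\<Sum>i<q. diagonal_aggregate (entry A i i) (entry B i i) (entry C i i) / 3
        - real q * block_form (entry A i i) (entry B i i) (entry C i i))"
proof -
  let ?K = "\<lambda>(i, j). block_form (entry A i j) (entry B i j) (entry C i j)"
  have inj: "inj_on (\<lambda>i. (i, i)) {..<q}" by (auto simp: inj_on_def)
  have "(\<Sum>i<q. \<Sum>j<q. ?K (i, j)) = sum ?K ({..<q} \<times> {..<q})"
    by (simp add: sum.cartesian_product)
  also have "\<dots> = sum ?K ({..<q} \<times> {..<q} - (\<lambda>i. (i, i)) ` {..<q}) + sum ?K ((\<lambda>i. (i, i)) ` {..<q})"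
    by (rule sum.subset_diff) auto
  also have "sum ?K ((\<lambda>i. (i, i)) ` {..<q}) = (\<Sum>i<q. ?K (i, i))"
    by (simp add: sum.reindex[OF inj])
  finally have K: "(\<Sum>i<q. \<Sum>j<q. ?K (i, j)) =
    sum ?K ({..<q} \<times> {..<q} - (\<lambda>i. (i, i)) ` {..<q}) + (\<Sum>i<q. ?K (i, i))" .
  have diag: "aggregates A B C i i i = diagonal_aggregate (entry A i i) (entry B i i) (entry C i i)" for i
    by (simp add: aggregates_def diagonal_aggregate_def aggregate_def)
  have "3 * signed_trace q A B C = sum3 q (aggregates A B C) - 3 * (q * (\<Sum>i<q. \<Sum>j<q. ?K (i, j)))"
    using sum3_aggregates[of q A B C] assms by simp
  also have "\<dots> = 3 * ((\<Sum>(i, j, k)\<in>cyclic_representatives q. aggregates A B C i j k)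
    + (\<Sum>x\<in>{..<q} \<times> {..<q} - (\<lambda>i. (i, i)) ` {..<q}. - real q * ?K x)
    + (\<Sum>i<q. aggregates A B C i i i / 3 - real q * ?K (i, i)))"
    unfolding K sum3_cyclic[of "aggregates A B C", OF aggregates_rotate]
    by (simp add: sum_subtractf sum_distrib_left sum_divide_distrib[symmetric] sum_negf algebra_simps
        flip: sum_distrib_left)
  finally show ?thesis by (simp add: diag case_prod_unfold)
qed

lemma trilinear_rank_le_signed_trace:
  assumes lin: "\<And>s t i j. linear_form (\<lambda>a. A a s t i j)" "\<And>s t i j. linear_form (\<lambda>b. B b s t i j)"
      "\<And>s t i j. linear_form (\<lambda>c. C c s t i j)"
    and zero: "\<And>a s t. zero_sums q (A a s t)" "\<And>b s t. zero_sums q (B b s t)"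
      "\<And>c s t. zero_sums q (C c s t)"
    and q: "q \<noteq> 0" "q \<noteq> 9"
  shows "trilinear_rank_le (\<lambda>a b c. signed_trace q (A a) (B b) (C c))
    (card (cyclic_representatives q) * 8 + (q * q - q) * 7 + q * 8)"
proof -
  note [intro] = lin
  have agg: "trilinear_rank_le (\<lambda>a b c. aggregates (A a) (B b) (C c) i j k) 8" for i j k
  proof -
    have "trilinear_rank_le (\<lambda>a b c. (sg s * sg t * sg u * (A a s t i j + A a u s j k + A a t u k i))
        * (B b t u j k + B b s t k i + B b u s i j) * (C c u s k i + C c t u i j + C c s t j k)) 1" for s t u
      by (rule trilinear_rank_le_product) (auto intro!: linear_form_intros)
    then have "trilinear_rank_le (\<lambda>a b c. sg s * sg t * sg u * aggregate (A a) (B b) (C c) s t u i j k) 1" for s t u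
      by (simp add: aggregate_def mult.assoc)
    then have "trilinear_rank_le (\<lambda>a b c. aggregates (A a) (B b) (C c) i j k)
        (card (UNIV :: bool set) * (card (UNIV :: bool set) * (card (UNIV :: bool set) * 1)))"
      unfolding aggregates_def by (intro trilinear_rank_le_sum_const) auto
    then show ?thesis by simp
  qed
  have card: "card ({..<q} \<times> {..<q} - (\<lambda>i. (i, i)) ` {..<q}) = q * q - q"
    by (subst card_Diff_subset) (auto simp: card_image inj_on_def)
  \<comment> \<open>Projections replace the tuple patterns so that the rule for sums
    unifies.\<close>
  have "trilinear_rank_le (\<lambda>a b c.
      (\<Sum>x\<in>cyclic_representatives q. aggregates (A a) (B b) (C c) (fst x) (fst (snd x)) (snd (snd x)))
    + (\<Sum>x\<in>{..<q} \<times> {..<q} - (\<lambda>i. (i, i)) ` {..<q}. - real q *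
        block_form (entry (A a) (fst x) (snd x)) (entry (B b) (fst x) (snd x)) (entry (C c) (fst x) (snd x)))
    + (\<Sum>i<q. diagonal_aggregate (entry (A a) i i) (entry (B b) i i) (entry (C c) i i) / 3
        - real q * block_form (entry (A a) i i) (entry (B b) i i) (entry (C c) i i)))
    (card (cyclic_representatives q) * 8
      + card ({..<q} \<times> {..<q} - (\<lambda>i. (i, i)) ` {..<q}) * 7 + card {..<q} * 8)"
    using q by (intro trilinear_rank_le_add trilinear_rank_le_sum_const agg
        trilinear_rank_le_block_form trilinear_rank_le_diagonal finite_cyclic_representatives)
      auto
  then show ?thesis
    by (simp add: signed_trace_eq[OF zero] card case_prod_unfold)
qed

section \<open>Matrices with zero row and column sums\<close>

text \<open>The \<open>(m + 1) \<times> m\<close> matrix \<open>P\<close>: the identity above a row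
  of \<open>- 1\<close>, so its columns sum to zero.\<close>

definition expand_rows :: "nat \<Rightarrow> nat \<Rightarrow> nat \<Rightarrow> real" where
  "expand_rows m x i = of_bool (x = i) - of_bool (x = m)"

text \<open>The \<open>m \<times> (m + 1)\<close> matrix \<open>Q\<close>; the constant
  \<open>1 / (m + 1)\<close> makes its rows sum to zero. The embedding is \<open>a\<close> to
  \<open>P a Q\<close>.\<close>

definition expand_cols :: "nat \<Rightarrow> nat \<Rightarrow> nat \<Rightarrow> real" where
  "expand_cols m j y = of_bool (j = y) - 1 / real (m + 1)"

definition expand :: "nat \<Rightarrow> (nat \<Rightarrow> nat \<Rightarrow> real) \<Rightarrow> nat \<Rightarrow> nat \<Rightarrow> real" where
  "expand m a x y = (\<Sum>i<m. \<Sum>j<m. expand_rows m x i * a i j * expand_cols m j y)"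

lemma sum_expand_rows: "i < m \<Longrightarrow> (\<Sum>x<m + 1. expand_rows m x i) = 0"
  by (simp add: expand_rows_def sum_subtractf of_bool_def sum.delta)

lemma sum_expand_cols: "j < m \<Longrightarrow> (\<Sum>y<m + 1. expand_cols m j y) = 0"
  by (simp add: expand_cols_def sum_subtractf of_bool_def sum.delta' sum.delta)

text \<open>That is, \<open>Q P = 1\<close>: a column of \<open>P\<close> takes the difference of
  two entries in a row of \<open>Q\<close>, where the constant cancels.\<close>

lemma sum_expand_cols_rows:
  assumes "j < m" "k < m"
  shows "(\<Sum>y<m + 1. expand_cols m j y * expand_rows m y k) = of_bool (j = k)"
proof -
  have "(\<Sum>y<m + 1. expand_cols m j y * expand_rows m y k) =
      (\<Sum>y<m + 1. (if y = k then expand_cols m j y else 0) - (if y = m then expand_cols m j y else 0))"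
    by (intro sum.cong) (auto simp: expand_rows_def)
  also have "\<dots> = expand_cols m j k - expand_cols m j m"
    using assms by (simp add: sum_subtractf sum.delta)
  also have "\<dots> = of_bool (j = k)"
    using assms by (simp add: expand_cols_def)
  finally show ?thesis .
qed

lemma zero_sums_expand: "zero_sums (m + 1) (expand m a)"
  unfolding zero_sums_def
proof (intro conjI allI)
  fix x
  have "(\<Sum>y<m + 1. expand m a x y) = (\<Sum>i<m. \<Sum>y<m + 1. \<Sum>j<m. expand_rows m x i * a i j * expand_cols m j y)"
    unfolding expand_def by (rule sum.swap)
  also have "\<dots> = (\<Sum>i<m. \<Sum>j<m. \<Sum>y<m + 1. expand_rows m x i * a i j * expand_cols m j y)"
    by (intro sum.cong refl sum.swap)
  also have "\<dots> = (\<Sum>i<m. \<Sum>j<m. expand_rows m x i * a i j * (\<Sum>y<m + 1. expand_cols m j y))"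
    by (simp only: sum_distrib_left)
  also have "\<dots> = 0"
    by (intro sum.neutral ballI) (simp only: lessThan_iff sum_expand_cols mult_zero_right)
  finally show "(\<Sum>y<m + 1. expand m a x y) = 0" .
next
  fix y
  have "(\<Sum>x<m + 1. expand m a x y) = (\<Sum>i<m. \<Sum>x<m + 1. \<Sum>j<m. expand_rows m x i * a i j * expand_cols m j y)"
    unfolding expand_def by (rule sum.swap)
  also have "\<dots> = (\<Sum>i<m. \<Sum>j<m. \<Sum>x<m + 1. expand_rows m x i * a i j * expand_cols m j y)"
    by (intro sum.cong refl sum.swap)
  also have "\<dots> = (\<Sum>i<m. \<Sum>j<m. (\<Sum>x<m + 1. expand_rows m x i) * (a i j * expand_cols m j y))"
    by (simp only: sum_distrib_right mult.assoc)
  also have "\<dots> = 0"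
    by (intro sum.neutral ballI) (simp only: lessThan_iff sum_expand_rows mult_zero_left)
  finally show "(\<Sum>x<m + 1. expand m a x y) = 0" .
qed

text \<open>\<open>Q P = 1\<close> between a row vector \<open>f\<close> and a column vector
  \<open>g\<close>.\<close>

lemma sum_expand_contract:
  "(\<Sum>y<m + 1. (\<Sum>j<m. f j * expand_cols m j y) * (\<Sum>k<m. expand_rows m y k * g k)) = (\<Sum>j<m. f j * g j)"
proof -
  have "(\<Sum>y<m + 1. (\<Sum>j<m. f j * expand_cols m j y) * (\<Sum>k<m. expand_rows m y k * g k)) =
      (\<Sum>y<m + 1. \<Sum>j<m. \<Sum>k<m. f j * g k * (expand_cols m j y * expand_rows m y k))"
    by (simp only: sum_product) (simp only: ac_simps)
  also have "\<dots> = (\<Sum>j<m. \<Sum>y<m + 1. \<Sum>k<m. f j * g k * (expand_cols m j y * expand_rows m y k))"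
    by (rule sum.swap)
  also have "\<dots> = (\<Sum>j<m. \<Sum>k<m. \<Sum>y<m + 1. f j * g k * (expand_cols m j y * expand_rows m y k))"
    by (intro sum.cong refl sum.swap)
  also have "\<dots> = (\<Sum>j<m. \<Sum>k<m. f j * g k * (\<Sum>y<m + 1. expand_cols m j y * expand_rows m y k))"
    by (simp only: sum_distrib_left)
  also have "\<dots> = (\<Sum>j<m. \<Sum>k<m. if k = j then f j * g j else 0)"
    by (intro sum.cong refl) (simp only: lessThan_iff sum_expand_cols_rows, simp)
  also have "\<dots> = (\<Sum>j<m. f j * g j)"
    by (simp add: sum.delta)
  finally show ?thesis .
qed

text \<open>Splitting off \<open>Q\<close> here and \<open>P\<close> in the next lemma exposes the
  inner \<open>Q P\<close> in a product of two expanded matrices.\<close>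

lemma expand_eq_cols: "expand m a x y = (\<Sum>j<m. (\<Sum>i<m. expand_rows m x i * a i j) * expand_cols m j y)"
  unfolding expand_def by (subst sum.swap) (simp only: sum_distrib_right)

lemma expand_eq_rows: "expand m a x y = (\<Sum>i<m. expand_rows m x i * (\<Sum>j<m. a i j * expand_cols m j y))"
  unfolding expand_def by (simp only: sum_distrib_left mult.assoc)

lemma expand_mult:
  "(\<Sum>y<m + 1. expand m a x y * expand m b y z) = expand m (\<lambda>i k. \<Sum>j<m. a i j * b j k) x z"
proof -
  have "(\<Sum>y<m + 1. expand m a x y * expand m b y z) =
      (\<Sum>j<m. (\<Sum>i<m. expand_rows m x i * a i j) * (\<Sum>k<m. b j k * expand_cols m k z))"
    unfolding expand_eq_cols[of m a] expand_eq_rows[of m b] by (rule sum_expand_contract)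
  also have "\<dots> = (\<Sum>j<m. \<Sum>i<m. \<Sum>k<m. expand_rows m x i * (a i j * b j k) * expand_cols m k z)"
    by (simp only: sum_product mult.assoc)
  also have "\<dots> = (\<Sum>i<m. \<Sum>j<m. \<Sum>k<m. expand_rows m x i * (a i j * b j k) * expand_cols m k z)"
    by (rule sum.swap)
  also have "\<dots> = (\<Sum>i<m. \<Sum>k<m. \<Sum>j<m. expand_rows m x i * (a i j * b j k) * expand_cols m k z)"
    by (intro sum.cong refl sum.swap)
  also have "\<dots> = expand m (\<lambda>i k. \<Sum>j<m. a i j * b j k) x z"
    unfolding expand_def by (simp only: sum_distrib_left sum_distrib_right)
  finally show ?thesis .
qed

lemma expand_trace: "(\<Sum>x<m + 1. \<Sum>y<m + 1. expand m a x y * expand m b y x) = (\<Sum>i<m. \<Sum>j<m. a i j * b j i)"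
proof -
  \<comment> \<open>The trace of \<open>P c Q\<close> is that of \<open>c Q P = c\<close>.\<close>
  have "(\<Sum>x<m + 1. expand m c x x) = (\<Sum>i<m. c i i)" for c
  proof -
    have "(\<Sum>x<m + 1. expand m c x x) =
        (\<Sum>i<m. \<Sum>x<m + 1. \<Sum>j<m. expand_rows m x i * c i j * expand_cols m j x)"
      unfolding expand_def by (rule sum.swap)
    also have "\<dots> = (\<Sum>i<m. \<Sum>j<m. \<Sum>x<m + 1. expand_rows m x i * c i j * expand_cols m j x)"
      by (intro sum.cong refl sum.swap)
    also have "\<dots> = (\<Sum>i<m. \<Sum>j<m. c i j * (\<Sum>x<m + 1. expand_cols m j x * expand_rows m x i))"
      by (simp only: sum_distrib_left ac_simps)
    also have "\<dots> = (\<Sum>i<m. \<Sum>j<m. if j = i then c i i else 0)"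
      by (intro sum.cong refl) (simp only: lessThan_iff sum_expand_cols_rows, simp)
    finally show ?thesis by (simp add: sum.delta)
  qed
  then show ?thesis by (simp only: expand_mult)
qed

lemma sum3_expand:
  "sum3 (m + 1) (\<lambda>x y z. expand m a x y * expand m b y z * expand m c z x) =
   sum3 m (\<lambda>i j k. a i j * b j k * c k i)"
proof -
  have "sum3 (m + 1) (\<lambda>x y z. expand m a x y * expand m b y z * expand m c z x) =
      (\<Sum>x<m + 1. \<Sum>y<m + 1. expand m a x y * (\<Sum>z<m + 1. expand m b y z * expand m c z x))"
    by (simp only: sum3_def sum_distrib_left mult.assoc)
  also have "\<dots> = (\<Sum>i<m. \<Sum>j<m. a i j * (\<Sum>k<m. b j k * c k i))"
    by (simp only: expand_mult[of m b _ c] expand_trace)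
  also have "\<dots> = sum3 m (\<lambda>i j k. a i j * b j k * c k i)"
    by (simp only: sum3_def sum_distrib_left mult.assoc)
  finally show ?thesis .
qed

section \<open>The algorithm\<close>

definition block_index :: "nat \<Rightarrow> bool \<Rightarrow> nat \<Rightarrow> nat" where
  "block_index m s i = of_bool s * m + i"

lemma sum_block_index: "(\<Sum>i<2 * m. f i) = (\<Sum>s\<in>UNIV. \<Sum>i<m. f (block_index m s i) :: real)"
proof -
  have "(\<Sum>i<2 * m. f i) = (\<Sum>i<m. f i) + (\<Sum>i=m..<m + m. f i)"
    using sum.atLeastLessThan_concat[of 0 m "m + m" f] by (simp add: atLeast0LessThan mult_2)
  also have "(\<Sum>i=m..<m + m. f i) = (\<Sum>i<m. f (m + i))"
    using sum.shift_bounds_nat_ivl[of f 0 m m] by (simp add: atLeast0LessThan add.commute)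
  finally show ?thesis by (simp add: UNIV_bool block_index_def add.commute)
qed

text \<open>The sign of the column block undoes the signs in \<open>signed_trace\<close>, since
  \<open>sg\<close> squares to 1.\<close>

definition expanded_blocks :: "nat \<Rightarrow> (nat \<Rightarrow> nat \<Rightarrow> real) \<Rightarrow> blocks" where
  "expanded_blocks m a s t = expand m (\<lambda>i j. sg t * a (block_index m s i) (block_index m t j))"

lemma signed_trace_expanded_blocks:
  "signed_trace (m + 1) (expanded_blocks m a) (expanded_blocks m b) (expanded_blocks m c) =
   (\<Sum>i<2 * m. \<Sum>j<2 * m. \<Sum>k<2 * m. a i j * b j k * c k i)"
proof -
  let ?f = "\<lambda>s t u i j k. a (block_index m s i) (block_index m t j)
    * b (block_index m t j) (block_index m u k) * c (block_index m u k) (block_index m s i)"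
  have sg: "sg s * sg t * sg u * (sg t * x * (sg u * y) * (sg s * z)) = x * y * z" for s t u x y z
    by (simp add: sg_def)
  have "signed_trace (m + 1) (expanded_blocks m a) (expanded_blocks m b) (expanded_blocks m c) =
      (\<Sum>s\<in>UNIV. \<Sum>t\<in>UNIV. \<Sum>u\<in>UNIV. sum3 m (?f s t u))"
    unfolding signed_trace_def expanded_blocks_def sum3_expand
    by (simp only: sum3_cmult[symmetric] sg)
  \<comment> \<open>The swaps bring each block label next to its inner index, so that every such
    pair merges into one index below \<open>2 * m\<close>.\<close>
  also have "\<dots> = (\<Sum>s\<in>UNIV. \<Sum>t\<in>UNIV. \<Sum>i<m. \<Sum>u\<in>UNIV. \<Sum>j<m. \<Sum>k<m. ?f s t u i j k)"
    unfolding sum3_def by (intro sum.cong refl sum.swap)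
  also have "\<dots> = (\<Sum>s\<in>UNIV. \<Sum>i<m. \<Sum>t\<in>UNIV. \<Sum>u\<in>UNIV. \<Sum>j<m. \<Sum>k<m. ?f s t u i j k)"
    by (intro sum.cong refl sum.swap)
  also have "\<dots> = (\<Sum>s\<in>UNIV. \<Sum>i<m. \<Sum>t\<in>UNIV. \<Sum>j<m. \<Sum>u\<in>UNIV. \<Sum>k<m. ?f s t u i j k)"
    by (intro sum.cong refl sum.swap)
  also have "\<dots> = (\<Sum>i<2 * m. \<Sum>j<2 * m. \<Sum>k<2 * m. a i j * b j k * c k i)"
    by (simp only: sum_block_index)
  finally show ?thesis .
qed

theorem theorem3p4:
  fixes n0 :: nat
  assumes "n0 > 0" and "even n0" and "n0 \<noteq> 16"
  shows "\<exists>(t :: nat) U V W.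
           real t = real n0 ^ 3 / 3 + 15 / 4 * real n0 ^ 2 + 61 / 6 * real n0 + 8 \<and>
           is_bilinear_mm_algorithm n0 n0 n0 t U V W"
proof -
  obtain m where m: "n0 = 2 * m" using assms(2) by (elim evenE)
  define q where "q = m + 1"
  define t where "t = card (cyclic_representatives q) * 8 + (q * q - q) * 7 + q * 8"
  have lin: "linear_form (\<lambda>a. expanded_blocks m a s t i j)" for s t i j
    unfolding expanded_blocks_def expand_def by (intro linear_form_intros)
  have zero: "zero_sums q (expanded_blocks m a s t)" for a s t
    unfolding q_def expanded_blocks_def by (rule zero_sums_expand)
  have "trilinear_rank_le (\<lambda>a b c. signed_trace q (expanded_blocks m a) (expanded_blocks m b)
      (expanded_blocks m c)) t"
    unfolding t_def
  proof (rule trilinear_rank_le_signed_trace[OF lin lin lin zero zero zero])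
    \<comment> \<open>\<open>q = 9\<close> would mean \<open>m = 8\<close>, the excluded
      \<open>n0 = 16\<close>.\<close>
    show "q \<noteq> 0" "q \<noteq> 9" using assms(3) by (auto simp: q_def m)
  qed
  then have "\<exists>U V W. is_bilinear_mm_algorithm n0 n0 n0 t U V W"
    unfolding q_def signed_trace_expanded_blocks m by (rule bilinear_mm_algorithm_of_trilinear_rank)
  moreover have "real t = real n0 ^ 3 / 3 + 15 / 4 * real n0 ^ 2 + 61 / 6 * real n0 + 8"
  proof -
    have "real (q * q - q) = real q * real q - real q"
      by (simp add: of_nat_diff)
    \<comment> \<open>The factor 3 clears the division in the number of orbits,
      \<open>(q^3 - q) / 3\<close>.\<close>
    then have "3 * real t = 8 * (real q ^ 3 - real q) + 21 * (real q * real q - real q) + 24 * real q"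
      using card_cyclic_representatives[of q] unfolding t_def by simp
    then show ?thesis
      by (simp add: q_def m power3_eq_cube power2_eq_square algebra_simps)
  qed
  ultimately show ?thesis by blast
qed

end
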